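(* Fix a group $g$ with parameters $\eta_g>0$, $R_g>0$, and consider the upper-bound queues $\hat Q_{g,t},\hat Z_{g,t}$ and lower-bound queues $\check Q_{g,t},\check Z_{g,t}$ with the dynamics given in the context. Suppose $\hat Q_{g,t}$, $\check Q_{g,t}$, $\hat Z_{g,t}$ and $\check Z_{g,t}$ have finite upper bounds, i.e. for all $t$, $\hat Q_{g,t}\le\hat Q_{g,max}$, $\check Q_{g,t}\le\check Q_{g,max}$, $\hat Z_{g,t}\le\hat Z_{g,max}$, and $\check Z_{g,t}\le\check Z_{g,max}$. Then the charging delay of all EVs in group $g$ is upper bounded by $\hat\delta_{g,max}$ time slots (for the upper-bound queue) and $\check\delta_{g,max}$ time slots (for the lower-bound queue), where $$\hat\delta_{g,max}:=\frac{(\hat Q_{g,max}+\hat Z_{g,max})R_g}{\eta_g},\qquad \check\delta_{g,max}:=\frac{(\check Q_{g,max}+\check Z_{g,max})R_g}{\eta_g}.$$ That is, any charging request $\hat a_{g,t}$ arriving in slot $t$ in the upper-bound queue is fulfilled on or before slot $t+\hat\delta_{g,max}$, and any charging request $\check a_{g,t}$ arriving in slot $t$ in the lower-bound queue is fulfilled on or before slot $t+\check\delta_{g,max}$.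
   Context: Electric vehicles (EVs) are classified into groups $g$ according to their allowed charging delay $R_g$; $\eta_g$ is a user-defined parameter. Time slots are $t=1,2,\dots$. For group $g$, $\hat a_{g,t},\check a_{g,t}\ge0$ are the upper and lower bounds of the charging demand arriving in slot $t$, and $\hat x_{g,t},\check x_{g,t}\ge0$ are the charging powers (service) in slot $t$ for the upper-bound and lower-bound queues. The charging task queues evolve by $$\hat Q_{g,t+1}=\max[\hat Q_{g,t}-\hat x_{g,t},0]+\hat a_{g,t},\qquad \check Q_{g,t+1}=\max[\check Q_{g,t}-\check x_{g,t},0]+\check a_{g,t},$$ and the delay-aware virtual queues by $$\hat Z_{g,t+1}=\max\Big\{\hat Z_{g,t}+\tfrac{\eta_g}{R_g}\mathbb I_{\hat Q_{g,t}>0}-\hat x_{g,t},\,0\Big\},\qquad \check Z_{g,t+1}=\max\Big\{\check Z_{g,t}+\tfrac{\eta_g}{R_g}\mathbb I_{\check Q_{g,t}>0}-\check x_{g,t},\,0\Big\},$$ where $\mathbb I_{Q>0}$ equals $1$ if $Q>0$ and $0$ otherwise. All queues start at $0$ at $t=1$. Charging tasks are served on a first-in-first-out basis: demand arriving in slot $t$ joins the back of the queue and can be served from slot $t+1$ on. The charging delay of a request arriving in slot $t$ is the number of slots after $t$ until it is fulfilled.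
   Formalization: The delay bound and the deadline slot are rounded up to whole slots (⌈δ_max⌉ and ⌈t+δ_max⌉), since for non-integer δ_max the literal bound fails: η=R=1, a_1=1/2, x_2=1, all else 0 gives δ_max=1/2 but delay 1. *)

theory Defs
  imports Complex_Main "HOL-Library.Extended_Nat"
begin

text \<open>Slots are the positive naturals; values of sequences at index 0 are never used.
  Arrivals \<open>a\<close> and service \<open>x\<close> are indexed by slot, and \<open>Q t\<close>, \<open>Z t\<close> are the queue values at the
  beginning of slot \<open>t\<close>.\<close>

definition task_queue :: "(nat \<Rightarrow> real) \<Rightarrow> (nat \<Rightarrow> real) \<Rightarrow> (nat \<Rightarrow> real) \<Rightarrow> bool" where
  "task_queue a x Q \<longleftrightarrow>
     Q 1 = 0 \<and> (\<forall>t\<ge>1. Q (t + 1) = max (Q t - x t) 0 + a t)"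

definition virtual_queue ::
  "real \<Rightarrow> real \<Rightarrow> (nat \<Rightarrow> real) \<Rightarrow> (nat \<Rightarrow> real) \<Rightarrow> (nat \<Rightarrow> real) \<Rightarrow> bool" where
  "virtual_queue \<eta> R x Q Z \<longleftrightarrow>
     Z 1 = 0 \<and>
     (\<forall>t\<ge>1. Z (t + 1) = max (Z t + \<eta> / R * (if Q t > 0 then 1 else 0) - x t) 0)"

text \<open>The first-in-first-out queue itself is a list, front first, of pairs of an arrival slot and
  the still unserved part of the demand that arrived in it. An amount \<open>y\<close> of service is spent on
  the front request first, and only what is left over reaches the next one.\<close>

fun fifo_serve :: "real \<Rightarrow> (nat \<times> real) list \<Rightarrow> (nat \<times> real) list" where
  "fifo_serve y [] = []"
| "fifo_serve y ((t, r) # q) =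
     (if r \<le> y then fifo_serve (y - r) q else (t, r - y) # q)"

text \<open>\<open>fifo_queue a x s\<close> is the content at the end of slot \<open>s\<close>: demand arriving in slot \<open>s\<close> joins
  after the service of slot \<open>s\<close>, so it is served from slot \<open>s + 1\<close> on. A slot without
  arriving demand creates no request.\<close>

primrec fifo_queue :: "(nat \<Rightarrow> real) \<Rightarrow> (nat \<Rightarrow> real) \<Rightarrow> nat \<Rightarrow> (nat \<times> real) list" where
  "fifo_queue a x 0 = []"
| "fifo_queue a x (Suc s) =
     fifo_serve (x (Suc s)) (fifo_queue a x s) @
     (if a (Suc s) > 0 then [(Suc s, a (Suc s))] else [])"

text \<open>The demand that arrived in slot \<open>t\<close> is completely served by the end of slot \<open>s\<close>.\<close>

definition fulfilled_by :: "(nat \<Rightarrow> real) \<Rightarrow> (nat \<Rightarrow> real) \<Rightarrow> nat \<Rightarrow> nat \<Rightarrow> bool" where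
  "fulfilled_by a x t s \<longleftrightarrow> t \<le> s \<and> t \<notin> fst ` set (fifo_queue a x s)"

text \<open>The delay is \<open>\<infinity>\<close> if the request is never fulfilled.\<close>

definition charging_delay :: "(nat \<Rightarrow> real) \<Rightarrow> (nat \<Rightarrow> real) \<Rightarrow> nat \<Rightarrow> enat" where
  "charging_delay a x t = (INF d\<in>{d. fulfilled_by a x t (t + d)}. enat d)"

text \<open>This is a real number, in general not an integer. Slot \<open>s\<close> is the time interval \<open>(s - 1, s]\<close>,
  so time \<open>t + \<delta>\<close> lies in slot \<open>\<lceil>t + \<delta>\<rceil>\<close>. Rounding down instead would give a false bound:
  demand 1/2 in slot 1 only and service 1 in slot 2 only, with \<open>\<eta> = R = 1\<close>, has \<open>Qmax = 1/2\<close> and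
  \<open>Zmax = 0\<close>, but delay 1.\<close>

definition max_delay :: "real \<Rightarrow> real \<Rightarrow> real \<Rightarrow> real \<Rightarrow> real" where
  "max_delay \<eta> R Qmax Zmax = (Qmax + Zmax) * R / \<eta>"

text \<open>The list model and the scalar recursion describe the same backlog.\<close>

lemma fifo_serve_pos:
  "\<forall>p\<in>set q. snd p > 0 \<Longrightarrow> \<forall>p\<in>set (fifo_serve y q). snd p > 0"
  by (induction y q rule: fifo_serve.induct) auto

lemma fifo_queue_pos: "\<forall>p\<in>set (fifo_queue a x s). snd p > 0"
proof (induction s)
  case (Suc s)
  then show ?case using fifo_serve_pos[OF Suc] by auto
qed simp

lemma sum_fifo_serve:
  assumes "\<forall>p\<in>set q. snd p > 0" "y \<ge> 0"
  shows "sum_list (map snd (fifo_serve y q)) = max (sum_list (map snd q) - y) 0"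
  using assms
proof (induction y q rule: fifo_serve.induct)
  case (2 y t r q)
  have "sum_list (map snd q) \<ge> 0"
    using "2.prems" by (intro sum_list_nonneg) (auto intro: less_imp_le)
  then show ?case using 2 by auto
qed simp

lemma fifo_queue_backlog:
  assumes "task_queue a x Q" "\<And>t. t \<ge> 1 \<Longrightarrow> a t \<ge> 0" "\<And>t. t \<ge> 1 \<Longrightarrow> x t \<ge> 0"
  shows "sum_list (map snd (fifo_queue a x s)) = Q (Suc s)"
proof (induction s)
  case 0
  then show ?case using assms(1) by (simp add: task_queue_def)
next
  case (Suc s)
  have "Q (Suc (Suc s)) = max (Q (Suc s) - x (Suc s)) 0 + a (Suc s)"
    using assms(1) by (simp add: task_queue_def)
  moreover have "a (Suc s) \<ge> 0" "x (Suc s) \<ge> 0"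
    using assms(2,3) by simp_all
  ultimately show ?case
    using sum_fifo_serve[OF fifo_queue_pos, of "x (Suc s)" a x s] Suc by auto
qed

end

theory Submission
  imports Defs
begin

text \<open>Suppose the request of slot \<open>t\<close> is still in the queue at the end of slot \<open>t + d\<close>. By the
  first-in-first-out rule the service of the slots \<open>t + 1, \<dots>, t + d\<close> went entirely to the backlog
  \<open>Q (t + 1)\<close> and did not exhaust it, so it amounts to less than \<open>Qmax\<close>. The queue was nonempty
  throughout, so \<open>Z\<close> grew by at least \<open>d * \<eta> / R\<close> minus that service while staying in
  \<open>[0, Zmax]\<close>. Hence \<open>d * \<eta> / R < Qmax + Zmax\<close>.\<close>

lemma fst_fifo_serve_subset: "fst ` set (fifo_serve y q) \<subseteq> fst ` set q"
  by (induction y q rule: fifo_serve.induct) auto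

text \<open>Service reaches \<open>q\<close> only after all of \<open>p\<close> is gone: it either
  stops inside \<open>p\<close>, so that exactly \<open>y\<close> is removed there, or clears
  \<open>p\<close> and passes some rest \<open>y'\<close> on to \<open>q\<close>.\<close>

lemma fifo_serve_append:
  "(\<exists>p'. fifo_serve y (p @ q) = p' @ q \<and> sum_list (map snd p') = sum_list (map snd p) - y) \<or>
   (\<exists>y'. fifo_serve y (p @ q) = fifo_serve y' q)"
proof (induction y p rule: fifo_serve.induct)
  case (2 y t r p)
  show ?case
  proof (cases "r \<le> y")
    case True
    with "2.IH" show ?thesis by (auto simp: algebra_simps)
  next
    case False
    then have "fifo_serve y (((t, r) # p) @ q) = ((t, r - y) # p) @ q" by simp
    then show ?thesis by (intro disjI1 exI[of _ "(t, r - y) # p"]) simp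
  qed
qed auto

text \<open>Here \<open>p\<close> is what survives of the content at the end of slot
  \<open>t\<close>, and \<open>q\<close> holds later arrivals. While \<open>p\<close> is nonempty it
  has absorbed all service since \<open>t\<close>, so the balance is exact; once \<open>p\<close> is
  empty, service may have gone to \<open>q\<close> or been wasted, hence the disjunction.\<close>

lemma fifo_queue_split:
  "\<exists>p q. fifo_queue a x (t + d) = p @ q \<and> (\<forall>i\<in>fst ` set q. i > t) \<and>
     (p = [] \<or> sum_list (map snd p) =
        sum_list (map snd (fifo_queue a x t)) - (\<Sum>s=t+1..t+d. x s))"
proof (induction d)
  case 0
  then show ?case by (intro exI[of _ "fifo_queue a x t"] exI[of _ "[]"]) simp
next
  case (Suc d)
  let ?new = "if a (Suc (t + d)) > 0 then [(Suc (t + d), a (Suc (t + d)))] else []"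
  let ?S = "sum_list (map snd (fifo_queue a x t))"
  obtain p q where pq: "fifo_queue a x (t + d) = p @ q" "\<forall>i\<in>fst ` set q. i > t"
    and sum: "p = [] \<or> sum_list (map snd p) = ?S - (\<Sum>s=t+1..t+d. x s)"
    using Suc by blast
  have step: "fifo_queue a x (t + Suc d) = fifo_serve (x (Suc (t + d))) (p @ q) @ ?new"
    by (simp add: pq(1))
  have late: "\<forall>i\<in>fst ` set (fifo_serve y q @ ?new). i > t" for y
    using pq(2) fst_fifo_serve_subset[of y q] unfolding image_subset_iff by fastforce
  show ?case
  proof (cases "\<exists>y'. fifo_serve (x (Suc (t + d))) (p @ q) = fifo_serve y' q")
    case True
    then obtain y' where "fifo_serve (x (Suc (t + d))) (p @ q) = fifo_serve y' q" by blast
    then show ?thesis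
      using step late[of y'] by (intro exI[of _ "[]"] exI[of _ "fifo_serve y' q @ ?new"]) simp
  next
    case False
    \<comment> \<open>For empty \<open>p\<close>, the full service of the slot would be a witness
      for the excluded \<open>y'\<close>.\<close>
    then have "p \<noteq> []" by auto
    obtain p' where p': "fifo_serve (x (Suc (t + d))) (p @ q) = p' @ q"
      "sum_list (map snd p') = sum_list (map snd p) - x (Suc (t + d))"
      using False fifo_serve_append by blast
    have "sum_list (map snd p') = ?S - (\<Sum>s=t+1..t+Suc d. x s)"
      using p'(2) sum \<open>p \<noteq> []\<close> by simp
    moreover have "\<forall>i\<in>fst ` set (q @ ?new). i > t"
      using pq(2) by auto
    ultimately show ?thesis
      using step p'(1) by (intro exI[of _ p'] exI[of _ "q @ ?new"]) simp
  qed
qed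

lemma sum_list_snd_pos:
  fixes q :: "(nat \<times> real) list"
  assumes "q \<noteq> []" "\<forall>u\<in>set q. snd u > 0"
  shows "sum_list (map snd q) > 0"
  using assms
proof (induction q rule: list_nonempty_induct)
  case (cons z q)
  then have "sum_list (map snd q) > 0" "snd z > 0" by simp_all
  then show ?case by simp
qed simp

text \<open>In the split above, request \<open>t\<close> cannot lie among the later arrivals
  \<open>q\<close>, so \<open>p\<close> is nonempty and its total is positive.\<close>

lemma service_less_backlog:
  assumes "t \<in> fst ` set (fifo_queue a x (t + d))"
  shows "(\<Sum>s=t+1..t+d. x s) < sum_list (map snd (fifo_queue a x t))"
proof -
  obtain p q where pq: "fifo_queue a x (t + d) = p @ q" "\<forall>i\<in>fst ` set q. i > t"
    and sum: "p = [] \<or> sum_list (map snd p) =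
      sum_list (map snd (fifo_queue a x t)) - (\<Sum>s=t+1..t+d. x s)"
    using fifo_queue_split[of a x t d] by blast
  have "p \<noteq> []"
    using assms pq by auto
  moreover have "\<forall>u\<in>set p. snd u > 0"
    using fifo_queue_pos[of a x "t + d"] by (simp add: pq(1))
  ultimately have "sum_list (map snd p) > 0"
    by (rule sum_list_snd_pos)
  then show ?thesis
    using sum \<open>p \<noteq> []\<close> by simp
qed

text \<open>Service adds no requests, and an arrival after slot \<open>t\<close> carries a later
  label, so presence propagates backwards in time down to slot \<open>t\<close>.\<close>

lemma fifo_queue_persist:
  assumes "t \<in> fst ` set (fifo_queue a x (t + d))" "e \<le> d"
  shows "t \<in> fst ` set (fifo_queue a x (t + e))"
  using assms(2,1)
proof (induction rule: inc_induct)
  case (step n)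
  have "t \<in> fst ` set (fifo_serve (x (Suc (t + n))) (fifo_queue a x (t + n)))"
    using step.IH[OF step.prems] by (auto split: if_splits)
  then show ?case using fst_fifo_serve_subset by blast
qed

lemma virtual_queue_nonneg:
  assumes "virtual_queue \<eta> R x Q Z" "t \<ge> 1"
  shows "Z t \<ge> 0"
proof (cases "t = 1")
  case False
  define s where "s = t - 1"
  have "t = s + 1" "s \<ge> 1" using assms(2) False by (auto simp: s_def)
  with assms(1) show ?thesis by (simp add: virtual_queue_def)
qed (use assms(1) in \<open>simp add: virtual_queue_def\<close>)

text \<open>Cutting off at 0 only raises \<open>Z\<close>, and the indicator is 1 throughout, so the
  one-step lower bounds telescope.\<close>

lemma virtual_queue_growth:
  assumes "virtual_queue \<eta> R x Q Z" "t \<ge> 1" "\<And>s. t \<le> s \<Longrightarrow> s < t + d \<Longrightarrow> Q s > 0"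
  shows "Z (t + d) \<ge> Z t + real d * (\<eta> / R) - (\<Sum>s=t..<t+d. x s)"
  using assms(3)
proof (induction d)
  case (Suc d)
  have "Q (t + d) > 0" using Suc.prems by simp
  moreover have "Z (t + d + 1) =
      max (Z (t + d) + \<eta> / R * (if Q (t + d) > 0 then 1 else 0) - x (t + d)) 0"
    using assms(1,2) by (simp add: virtual_queue_def)
  ultimately have "Z (t + Suc d) \<ge> Z (t + d) + \<eta> / R - x (t + d)" by simp
  moreover have "Z (t + d) \<ge> Z t + real d * (\<eta> / R) - (\<Sum>s=t..<t+d. x s)"
    using Suc by simp
  ultimately show ?case by (simp add: distrib_right add_divide_distrib)
qed simp

text \<open>Both queues obey the same dynamics, so one generic statement serves for each of
  them.\<close>

lemma delay_bound:
  assumes "\<eta> > 0" "R > 0"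
    and nonneg: "\<And>t. t \<ge> 1 \<Longrightarrow> a t \<ge> 0" "\<And>t. t \<ge> 1 \<Longrightarrow> x t \<ge> 0"
    and Q: "task_queue a x Q" and Z: "virtual_queue \<eta> R x Q Z"
    and Qmax: "\<And>t. t \<ge> 1 \<Longrightarrow> Q t \<le> Qmax" and Zmax: "\<And>t. t \<ge> 1 \<Longrightarrow> Z t \<le> Zmax"
  shows "charging_delay a x t \<le> enat (nat \<lceil>max_delay \<eta> R Qmax Zmax\<rceil>)"
    and "fulfilled_by a x t (nat \<lceil>real t + max_delay \<eta> R Qmax Zmax\<rceil>)"
proof -
  let ?\<delta> = "max_delay \<eta> R Qmax Zmax"
  define d where "d = nat \<lceil>?\<delta>\<rceil>"
  note backlog = fifo_queue_backlog[OF Q nonneg]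
  \<comment> \<open>The bounds dominate the initial values 0. Hence \<open>nat\<close> does not
    truncate the ceiling.\<close>
  have "Qmax \<ge> 0" "Zmax \<ge> 0"
    using Qmax[of 1] Zmax[of 1] Q Z by (auto simp: task_queue_def virtual_queue_def)
  then have "?\<delta> \<ge> 0"
    using assms(1,2) by (simp add: max_delay_def)
  have ful: "fulfilled_by a x t (t + d)"
  proof (rule ccontr)
    assume "\<not> ?thesis"
    then have t: "t \<in> fst ` set (fifo_queue a x (t + d))"
      by (simp add: fulfilled_by_def)
    \<comment> \<open>Since \<open>Q s\<close> is the backlog at the end of slot
      \<open>s - 1\<close>, the offset \<open>e\<close> is \<open>s - Suc t\<close>.\<close>
    have "Q s > 0" if "t + 1 \<le> s" "s < t + 1 + d" for s
    proof -
      define e where "e = s - Suc t"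
      have e: "s = Suc (t + e)" "e \<le> d"
        using that by (auto simp: e_def)
      have "fifo_queue a x (t + e) \<noteq> []"
        using fifo_queue_persist[OF t e(2)] by auto
      then have "sum_list (map snd (fifo_queue a x (t + e))) > 0"
        using fifo_queue_pos by (rule sum_list_snd_pos)
      then show ?thesis
        using backlog[of "t + e"] e(1) by simp
    qed
    \<comment> \<open>Growth is counted from slot \<open>t + 1\<close>, the first in which the
      request can be served.\<close>
    then have "Z (t + 1 + d) \<ge> Z (t + 1) + real d * (\<eta> / R) - (\<Sum>s=t+1..t+d. x s)"
      using virtual_queue_growth[OF Z, of "t + 1" d] by (simp add: atLeastLessThanSuc_atLeastAtMost)
    moreover have "(\<Sum>s=t+1..t+d. x s) < Q (t + 1)"
      using service_less_backlog[OF t] backlog by simp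
    moreover have "Z (t + 1) \<ge> 0"
      by (intro virtual_queue_nonneg[OF Z]) simp
    ultimately have "real d * (\<eta> / R) < Qmax + Zmax"
      using Qmax[of "t + 1"] Zmax[of "t + 1 + d"] by linarith
    then have "real d < ?\<delta>"
      using assms(1,2) by (simp add: max_delay_def field_simps)
    then show False
      unfolding d_def by linarith
  qed
  show "charging_delay a x t \<le> enat (nat \<lceil>?\<delta>\<rceil>)"
    unfolding charging_delay_def using ful by (intro INF_lower) (simp add: d_def)
  \<comment> \<open>The ceiling commutes with adding the integer \<open>t\<close>, so both
    conclusions name the same slot.\<close>
  have "nat \<lceil>real t + ?\<delta>\<rceil> = t + d"
    using \<open>?\<delta> \<ge> 0\<close> unfolding d_def by linarith
  then show "fulfilled_by a x t (nat \<lceil>real t + ?\<delta>\<rceil>)"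
    using ful by simp
qed

theorem proposition2:
  fixes \<eta> R :: real
    and a_hat a_check x_hat x_check :: "nat \<Rightarrow> real"
    and Q_hat Q_check Z_hat Z_check :: "nat \<Rightarrow> real"
    and Q_hat_max Q_check_max Z_hat_max Z_check_max :: real
  assumes "\<eta> > 0" and "R > 0"
    and "\<And>t. t \<ge> 1 \<Longrightarrow> a_hat t \<ge> 0" and "\<And>t. t \<ge> 1 \<Longrightarrow> a_check t \<ge> 0"
    and "\<And>t. t \<ge> 1 \<Longrightarrow> x_hat t \<ge> 0" and "\<And>t. t \<ge> 1 \<Longrightarrow> x_check t \<ge> 0"
    and "task_queue a_hat x_hat Q_hat" and "task_queue a_check x_check Q_check"
    and "virtual_queue \<eta> R x_hat Q_hat Z_hat" and "virtual_queue \<eta> R x_check Q_check Z_check"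
    and "\<And>t. t \<ge> 1 \<Longrightarrow> Q_hat t \<le> Q_hat_max" and "\<And>t. t \<ge> 1 \<Longrightarrow> Q_check t \<le> Q_check_max"
    and "\<And>t. t \<ge> 1 \<Longrightarrow> Z_hat t \<le> Z_hat_max" and "\<And>t. t \<ge> 1 \<Longrightarrow> Z_check t \<le> Z_check_max"
  shows "\<forall>t\<ge>1.
      charging_delay a_hat x_hat t \<le> enat (nat \<lceil>max_delay \<eta> R Q_hat_max Z_hat_max\<rceil>) \<and>
      fulfilled_by a_hat x_hat t (nat \<lceil>real t + max_delay \<eta> R Q_hat_max Z_hat_max\<rceil>) \<and>
      charging_delay a_check x_check t \<le> enat (nat \<lceil>max_delay \<eta> R Q_check_max Z_check_max\<rceil>) \<and>
      fulfilled_by a_check x_check t (nat \<lceil>real t + max_delay \<eta> R Q_check_max Z_check_max\<rceil>)"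
  by (intro allI impI conjI delay_bound[OF assms(1,2,3,5,7,9,11,13)]
      delay_bound[OF assms(1,2,4,6,8,10,12,14)])

end
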